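(* For $n\ge 3$ let $G$ be the straight linear 2-tree on $n$ vertices and $H$ the straight linear 2-tree on $n+1$ vertices. Then \[ \lim_{n\to\infty}\left[r_H(1,n+1)-r_G(1,n)\right]=\frac15 . \]
   Context: The straight linear 2-tree on $n$ vertices is the graph with vertex set $\{1,\dots,n\}$ in which $\{i,j\}$ is an edge if and only if $0<|i-j|\le 2$. Every edge is a unit resistor, and $r_G(i,j)=(\mathbf e_i-\mathbf e_j)^TL(G)^{\dagger}(\mathbf e_i-\mathbf e_j)$ is the resistance distance, with $L(G)^\dagger$ the Moore–Penrose inverse of the Laplacian of $G$. *)

theory Defs
  imports Complex_Main Jordan_Normal_Form.Matrix
begin

text \<open>
  A graph is a pair \<open>(n, E)\<close>: the vertex set is \<open>{1..n}\<close> and \<open>E\<close> is a set of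
  two-element subsets of it. Matrix and vector indices start at \<open>0\<close>, so vertex \<open>v\<close> belongs to
  index \<open>v - 1\<close>.
\<close>

type_synonym graph = "nat \<times> nat set set"

definition straight_linear_2tree :: "nat \<Rightarrow> graph" where
  "straight_linear_2tree n =
     (n, {{i, j} | i j. i \<in> {1..n} \<and> j \<in> {1..n} \<and>
                        0 < \<bar>int i - int j\<bar> \<and> \<bar>int i - int j\<bar> \<le> 2})"

definition degree :: "graph \<Rightarrow> nat \<Rightarrow> nat" where
  "degree G v = card {e \<in> snd G. v \<in> e}"

definition adjacency_matrix :: "graph \<Rightarrow> real mat" where
  "adjacency_matrix G =
     mat (fst G) (fst G) (\<lambda>(i, j). if {i + 1, j + 1} \<in> snd G then 1 else 0)"

definition degree_matrix :: "graph \<Rightarrow> real mat" where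
  "degree_matrix G = mat_diag (fst G) (\<lambda>i. real (degree G (i + 1)))"

definition laplacian :: "graph \<Rightarrow> real mat" where
  "laplacian G = degree_matrix G - adjacency_matrix G"

definition is_moore_penrose_inverse :: "real mat \<Rightarrow> real mat \<Rightarrow> bool" where
  "is_moore_penrose_inverse A X \<longleftrightarrow>
     X \<in> carrier_mat (dim_col A) (dim_row A) \<and>
     A * X * A = A \<and> X * A * X = X \<and>
     transpose_mat (A * X) = A * X \<and> transpose_mat (X * A) = X * A"

lemma moore_penrose_inverse_unique:
  assumes X: "is_moore_penrose_inverse A X" and Y: "is_moore_penrose_inverse A Y"
  shows "X = Y"
proof -
  note X' = X[unfolded is_moore_penrose_inverse_def]
  note Y' = Y[unfolded is_moore_penrose_inverse_def]
  note Xc = X'[THEN conjunct1]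
  note X1 = X'[THEN conjunct2, THEN conjunct1]
  note X2 = X'[THEN conjunct2, THEN conjunct2, THEN conjunct1]
  note X3 = X'[THEN conjunct2, THEN conjunct2, THEN conjunct2, THEN conjunct1]
  note X4 = X'[THEN conjunct2, THEN conjunct2, THEN conjunct2, THEN conjunct2]
  note Yc = Y'[THEN conjunct1]
  note Y1 = Y'[THEN conjunct2, THEN conjunct1]
  note Y2 = Y'[THEN conjunct2, THEN conjunct2, THEN conjunct1]
  note Y3 = Y'[THEN conjunct2, THEN conjunct2, THEN conjunct2, THEN conjunct1]
  note Y4 = Y'[THEN conjunct2, THEN conjunct2, THEN conjunct2, THEN conjunct2]
  have A: "A \<in> carrier_mat (dim_row A) (dim_col A)" by (rule carrier_matI) (rule refl)+
  note AX = mult_carrier_mat[OF A Xc] and AY = mult_carrier_mat[OF A Yc]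
  note XA = mult_carrier_mat[OF Xc A] and YA = mult_carrier_mat[OF Yc A]
  have L1: "(A * Y) * (A * X) = A * X"
    by (simp only: assoc_mult_mat[OF AY A Xc, symmetric] Y1)
  have L2: "(A * X) * (A * Y) = A * Y"
    by (simp only: assoc_mult_mat[OF AX A Yc, symmetric] X1)
  have L3: "transpose_mat ((A * Y) * (A * X)) = (A * X) * (A * Y)"
    by (simp only: transpose_mult[OF AY AX] X3 Y3)
  have eqL: "A * X = A * Y"
    using L3 unfolding L1 L2 X3 .
  have R1: "(X * A) * (Y * A) = X * A"
    by (simp only: assoc_mult_mat[OF Xc A YA] assoc_mult_mat[OF A Yc A, symmetric] Y1)
  have R2: "(Y * A) * (X * A) = Y * A"
    by (simp only: assoc_mult_mat[OF Yc A XA] assoc_mult_mat[OF A Xc A, symmetric] X1)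
  have R3: "transpose_mat ((X * A) * (Y * A)) = (Y * A) * (X * A)"
    by (simp only: transpose_mult[OF XA YA] X4 Y4)
  have eqR: "X * A = Y * A"
    using R3 unfolding R1 R2 X4 .
  have "X * A * X = Y * A * Y"
    by (rule trans[OF assoc_mult_mat[OF Xc A Xc]])
      (simp only: eqL assoc_mult_mat[OF Xc A Yc, symmetric] eqR)
  then show ?thesis unfolding X2 Y2 .
qed

definition moore_penrose_inverse :: "real mat \<Rightarrow> real mat" where
  "moore_penrose_inverse A = (THE X. is_moore_penrose_inverse A X)"

definition resistance_distance :: "graph \<Rightarrow> nat \<Rightarrow> nat \<Rightarrow> real" where
  "resistance_distance G i j =
     (let d = unit_vec (fst G) (i - 1) - unit_vec (fst G) (j - 1)
      in d \<bullet> (moore_penrose_inverse (laplacian G) *\<^sub>v d))"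

end

theory Submission
  imports Defs Jordan_Normal_Form.Determinant
begin

text \<open>For a connected graph, \<open>L\<^sup>\<dagger> = (L + J / n)\<^sup>-\<^sup>1 - J / n\<close> with \<open>J\<close> the all-ones matrix, and the resistance
  distance is the potential difference \<open>x i - x j\<close> of any solution of
  \<open>L x = e i - e j\<close>. For the straight linear 2-tree and its two end vertices, the potential
  drop at step \<open>k\<close> is \<open>1 / 5\<close> up to an error decaying geometrically in the distance to
  the ends. The total error therefore converges, and the resistance distance increases asymptotically
  by \<open>1 / 5\<close> per vertex.\<close>

section \<open>Pseudoinverses\<close>

lemma moore_penrose_inverse_eqI:
  assumes "is_moore_penrose_inverse A X"
  shows "moore_penrose_inverse A = X"
  unfolding moore_penrose_inverse_def
  using assms by (blast intro: moore_penrose_inverse_unique)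

lemma minus_zero_mat_right:
  fixes A :: "real mat"
  assumes "A \<in> carrier_mat m n"
  shows "A - 0\<^sub>m m n = A"
  using assms by (intro eq_matI) auto

text \<open>\<open>P\<close> is the orthogonal projection onto the kernel of \<open>A\<close>. A
  vector killed by \<open>A + P\<close> is killed by \<open>P\<close>, then by \<open>A\<close>,
  hence is fixed by \<open>P\<close> and zero. So \<open>A + P\<close> is invertible.\<close>

lemma moore_penrose_from_kernel_projection:
  fixes A P :: "real mat"
  assumes A: "A \<in> carrier_mat n n" and P: "P \<in> carrier_mat n n"
    and PP: "P * P = P" and Pt: "transpose_mat P = P"
    and AP: "A * P = 0\<^sub>m n n" and PA: "P * A = 0\<^sub>m n n"
    and ker: "\<And>v. v \<in> carrier_vec n \<Longrightarrow> A *\<^sub>v v = 0\<^sub>v n \<Longrightarrow> P *\<^sub>v v = v"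
  shows "\<exists>X. is_moore_penrose_inverse A X"
proof -
  let ?M = "A + P"
  have M: "?M \<in> carrier_mat n n" using A P by simp
  have PM: "P * ?M = P"
    using A P PA PP by (simp add: mult_add_distrib_mat[of _ n n])
  have MP: "?M * P = P"
    using A P AP PP by (simp add: add_mult_distrib_mat[of _ n n])
  have "det ?M \<noteq> 0"
  proof
    assume "det ?M = 0"
    then obtain v where v: "v \<in> carrier_vec n" "v \<noteq> 0\<^sub>v n" "?M *\<^sub>v v = 0\<^sub>v n"
      using det_0_iff_vec_prod_zero_field[OF M] by auto
    have "P *\<^sub>v v = P *\<^sub>v (?M *\<^sub>v v)"
      using PM v(1) P M by (metis assoc_mult_mat_vec)
    then have Pv: "P *\<^sub>v v = 0\<^sub>v n"
      using v(3) P by (auto intro!: eq_vecI)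
    have "?M *\<^sub>v v = A *\<^sub>v v + P *\<^sub>v v"
      using A P v(1) by (simp add: add_mult_distrib_mat_vec)
    then have "A *\<^sub>v v = 0\<^sub>v n"
      using v(3) Pv A v(1) by (metis mult_mat_vec_carrier right_zero_vec)
    then show False using ker[OF v(1)] Pv v(2) by simp
  qed
  then obtain B where B: "B \<in> carrier_mat n n" and BM: "B * ?M = 1\<^sub>m n" and MB: "?M * B = 1\<^sub>m n"
    using det_non_zero_imp_unit[OF M] unfolding Units_def ring_mat_def by auto
  have PB: "P * B = P"
    using assoc_mult_mat[OF P M B] PM MB right_mult_one_mat[OF P] by simp
  have BP: "B * P = P"
    using assoc_mult_mat[OF B M P] MP BM left_mult_one_mat[OF P] by simp
  have A_eq: "A = ?M - P"
    using A P by (intro eq_matI) auto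
  have AB: "A * B = 1\<^sub>m n - P"
    using minus_mult_distrib_mat[OF M P B] A_eq MB PB by simp
  have BA: "B * A = 1\<^sub>m n - P"
    using mult_minus_distrib_mat[OF B M P] A_eq BM BP by simp
  \<comment> \<open>\<open>B\<close> acts as the identity on the range of \<open>P\<close>, and
    subtracting \<open>P\<close> makes it vanish there. Both products with \<open>A\<close> become
    the symmetric projection \<open>1\<^sub>m n - P\<close>, which fixes \<open>A\<close> and
    \<open>?X\<close>.\<close>
  let ?X = "B - P"
  have X: "?X \<in> carrier_mat n n" using P by (rule minus_carrier_mat)
  have AX: "A * ?X = 1\<^sub>m n - P"
    using mult_minus_distrib_mat[OF A B P] AB AP P minus_zero_mat_right[of "1\<^sub>m n - P" n n] minus_carrier_mat[OF P] by simp
  have XA: "?X * A = 1\<^sub>m n - P"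
    using minus_mult_distrib_mat[OF B P A] BA PA P minus_zero_mat_right[of "1\<^sub>m n - P" n n] minus_carrier_mat[OF P] by simp
  have PX: "P * ?X = 0\<^sub>m n n"
    using mult_minus_distrib_mat[OF P B P] PB PP P by simp
  have sym: "transpose_mat (1\<^sub>m n - P) = 1\<^sub>m n - P"
    using transpose_minus[OF one_carrier_mat P] Pt by simp
  have "(1\<^sub>m n - P) * A = A"
    using minus_mult_distrib_mat[OF one_carrier_mat P A] PA A minus_zero_mat_right[OF A] by simp
  moreover have "(1\<^sub>m n - P) * ?X = ?X"
    using minus_mult_distrib_mat[OF one_carrier_mat P X] PX left_mult_one_mat[OF X] minus_zero_mat_right[OF X] by simp
  ultimately have "is_moore_penrose_inverse A ?X"
    unfolding is_moore_penrose_inverse_def using A X AX XA sym by simp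
  then show ?thesis ..
qed

text \<open>Symmetry moves \<open>A\<close> across the scalar product and
  \<open>A * X * A = A\<close> absorbs \<open>X\<close>, so on the range of \<open>A\<close> the
  form can be computed without knowing \<open>X\<close>.\<close>

lemma moore_penrose_quadratic_form:
  assumes X: "is_moore_penrose_inverse A X"
    and A: "A \<in> carrier_mat n n" and At: "transpose_mat A = A"
    and v: "v \<in> carrier_vec n"
  shows "(A *\<^sub>v v) \<bullet> (X *\<^sub>v (A *\<^sub>v v)) = v \<bullet> (A *\<^sub>v v)"
proof -
  have Xc: "X \<in> carrier_mat n n" and AXA: "A * X * A = A"
    using X A unfolding is_moore_penrose_inverse_def by auto
  have "(A *\<^sub>v v) \<bullet> (X *\<^sub>v (A *\<^sub>v v)) = v \<bullet> (A *\<^sub>v (X *\<^sub>v (A *\<^sub>v v)))"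
    using transpose_vec_mult_scalar[OF A _ v, of "X *\<^sub>v (A *\<^sub>v v)"] A At v Xc
      comm_scalar_prod[of _ n]
    by (metis mult_mat_vec_carrier)
  also have "A *\<^sub>v (X *\<^sub>v (A *\<^sub>v v)) = (A * X * A) *\<^sub>v v"
    using A Xc v by (simp add: assoc_mult_mat_vec[of _ n n _ n] del: assoc_mult_mat)
  finally show ?thesis using AXA by simp
qed

section \<open>Laplacians of connected graphs\<close>

definition simple_graph :: "graph \<Rightarrow> bool" where
  "simple_graph G \<longleftrightarrow>
     snd G \<subseteq> {{u, v} | u v. u \<in> {1..fst G} \<and> v \<in> {1..fst G} \<and> u \<noteq> v}"

definition connected_graph :: "graph \<Rightarrow> bool" where
  "connected_graph G \<longleftrightarrow>
     (\<forall>u \<in> {1..fst G}. \<forall>v \<in> {1..fst G}. (u, v) \<in> {(a, b). {a, b} \<in> snd G}\<^sup>*)"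

definition adj :: "graph \<Rightarrow> nat \<Rightarrow> nat \<Rightarrow> real" where
  "adj G i j = (if {i + 1, j + 1} \<in> snd G then 1 else 0)"

lemma adj_sym: "adj G i j = adj G j i"
  by (simp add: adj_def insert_commute)

text \<open>\<open>degree\<close> counts edges, a Laplacian row counts neighbours; sending an edge
  at the vertex to its other endpoint matches them.\<close>

lemma degree_eq_sum:
  assumes "simple_graph G"
  shows "real (Defs.degree G (i + 1)) = (\<Sum>j<fst G. adj G i j)"
proof -
  have "bij_betw (\<lambda>j. {i + 1, j + 1}) {j. j < fst G \<and> {i + 1, j + 1} \<in> snd G}
          {e \<in> snd G. i + 1 \<in> e}"
  proof (rule bij_betwI')
    fix e assume "e \<in> {e \<in> snd G. i + 1 \<in> e}"
    then have e: "e \<in> snd G" "i + 1 \<in> e" by auto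
    then obtain u v where uv: "e = {u, v}" "u \<in> {1..fst G}" "v \<in> {1..fst G}"
      using assms unfolding simple_graph_def by blast
    define w where "w = (if u = i + 1 then v else u)"
    have "e = {i + 1, (w - 1) + 1}" "w - 1 < fst G"
      using e(2) uv unfolding w_def by auto
    then show "\<exists>j \<in> {j. j < fst G \<and> {i + 1, j + 1} \<in> snd G}. e = {i + 1, j + 1}"
      using e(1) by blast
  qed (auto simp: doubleton_eq_iff)
  then have "Defs.degree G (i + 1) = card {j. j < fst G \<and> {i + 1, j + 1} \<in> snd G}"
    unfolding Defs.degree_def by (rule bij_betw_same_card[symmetric])
  also have "\<dots> = (\<Sum>j<fst G. if {i + 1, j + 1} \<in> snd G then 1 else 0)"
    by (simp add: sum.If_cases Int_def)
  finally show ?thesis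
    by (simp add: adj_def if_distrib cong: if_cong)
qed

lemma laplacian_carrier: "laplacian G \<in> carrier_mat (fst G) (fst G)"
  by (intro carrier_matI) (simp_all add: laplacian_def degree_matrix_def adjacency_matrix_def)

lemma laplacian_index:
  assumes "i < fst G" "j < fst G"
  shows "laplacian G $$ (i, j) = (if i = j then real (Defs.degree G (i + 1)) else 0) - adj G i j"
  using assms
  by (auto simp: laplacian_def degree_matrix_def adjacency_matrix_def mat_diag_def adj_def)

lemma laplacian_symmetric: "transpose_mat (laplacian G) = laplacian G"
  using laplacian_carrier[of G]
  by (intro eq_matI) (auto simp: laplacian_index adj_sym)

text \<open>With the degree as a row sum of \<open>adj\<close>, the product becomes the net current
  leaving a vertex under the potential \<open>v\<close>.\<close>

lemma laplacian_mult_vec_index: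
  assumes G: "simple_graph G" and v: "v \<in> carrier_vec (fst G)" and i: "i < fst G"
  shows "(laplacian G *\<^sub>v v) $ i = (\<Sum>j<fst G. adj G i j * (v $ i - v $ j))"
proof -
  have "(laplacian G *\<^sub>v v) $ i = (\<Sum>j<fst G. laplacian G $$ (i, j) * v $ j)"
    using laplacian_carrier[of G] v i by (simp add: scalar_prod_def atLeast0LessThan)
  also have "\<dots> = (\<Sum>j<fst G. (if i = j then real (Defs.degree G (i + 1)) * v $ i else 0)
                     - adj G i j * v $ j)"
    using i by (intro sum.cong) (auto simp: laplacian_index left_diff_distrib)
  also have "\<dots> = real (Defs.degree G (i + 1)) * v $ i - (\<Sum>j<fst G. adj G i j * v $ j)"
    using i by (simp add: sum_subtractf)
  also have "\<dots> = (\<Sum>j<fst G. adj G i j * (v $ i - v $ j))"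
    unfolding degree_eq_sum[OF G] by (simp add: right_diff_distrib sum_subtractf sum_distrib_right)
  finally show ?thesis .
qed

text \<open>Split \<open>(x i - x j)\<^sup>2\<close> into
  \<open>x i * (x i - x j) + x j * (x j - x i)\<close>; exchanging \<open>i\<close> and
  \<open>j\<close> shows that both halves have the same sum.\<close>

lemma dirichlet_form:
  fixes x :: "nat \<Rightarrow> real"
  shows "(\<Sum>i<n. \<Sum>j<n. adj G i j * (x i - x j)\<^sup>2)
           = 2 * (\<Sum>i<n. x i * (\<Sum>j<n. adj G i j * (x i - x j)))"
proof -
  have "(\<Sum>i<n. \<Sum>j<n. adj G i j * x j * (x j - x i))
          = (\<Sum>i<n. \<Sum>j<n. adj G i j * x i * (x i - x j))"
    by (subst sum.swap) (simp add: adj_sym)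
  then have "(\<Sum>i<n. \<Sum>j<n. adj G i j * x i * (x i - x j) + adj G i j * x j * (x j - x i))
          = 2 * (\<Sum>i<n. \<Sum>j<n. adj G i j * x i * (x i - x j))"
    by (simp add: sum.distrib)
  then show ?thesis
    by (simp add: sum_distrib_left power2_eq_square algebra_simps)
qed

text \<open>On the kernel the Dirichlet energy vanishes, so every edge joins equal values, and paths
  carry the equality through the graph.\<close>

lemma laplacian_kernel:
  assumes G: "simple_graph G" "connected_graph G"
    and v: "v \<in> carrier_vec (fst G)" and ker: "laplacian G *\<^sub>v v = 0\<^sub>v (fst G)"
    and ij: "i < fst G" "j < fst G"
  shows "v $ i = v $ j"
proof -
  let ?n = "fst G"
  have row: "(\<Sum>j<?n. adj G i j * (v $ i - v $ j)) = 0" if "i < ?n" for i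
    using laplacian_mult_vec_index[OF G(1) v that] ker that by simp
  have nonneg: "0 \<le> adj G i j * (v $ i - v $ j)\<^sup>2" for i j
    by (simp add: adj_def)
  have "(\<Sum>i<?n. \<Sum>j<?n. adj G i j * (v $ i - v $ j)\<^sup>2) = 0"
    unfolding dirichlet_form using row by simp
  then have zero: "adj G i j * (v $ i - v $ j)\<^sup>2 = 0" if "i < ?n" "j < ?n" for i j
    using that nonneg by (simp add: sum_nonneg_eq_0_iff sum_nonneg)
  have edge: "v $ (a - 1) = v $ (b - 1)" if "{a, b} \<in> snd G" for a b
  proof -
    have "a \<in> {1..?n}" "b \<in> {1..?n}"
      using that G(1) unfolding simple_graph_def by (force simp: doubleton_eq_iff)+
    then show ?thesis
      using zero[of "a - 1" "b - 1"] that by (auto simp: adj_def)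
  qed
  have "(i + 1, j + 1) \<in> {(a, b). {a, b} \<in> snd G}\<^sup>*"
    using G(2) ij unfolding connected_graph_def by auto
  then have "v $ (i + 1 - 1) = v $ (j + 1 - 1)"
    by (induction rule: rtrancl_induct) (use edge in auto)
  then show ?thesis by simp
qed

lemma laplacian_moore_penrose_exists:
  assumes G: "simple_graph G" "connected_graph G"
  shows "\<exists>X. is_moore_penrose_inverse (laplacian G) X"
proof -
  let ?n = "fst G" and ?L = "laplacian G"
  \<comment> \<open>Averaging projects orthogonally onto the constant vectors, which form the kernel
    by connectedness.\<close>
  define P where "P = mat ?n ?n (\<lambda>_. 1 / real ?n)"
  have P: "P \<in> carrier_mat ?n ?n" by (simp add: P_def)
  have Pt: "transpose_mat P = P" by (intro eq_matI) (auto simp: P_def)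
  note L = laplacian_carrier[of G]
  have rows: "(\<Sum>k<?n. ?L $$ (i, k)) = 0" if "i < ?n" for i
  proof -
    have "(?L *\<^sub>v vec ?n (\<lambda>_. 1)) $ i = 0"
      using laplacian_mult_vec_index[OF G(1) _ that] that by simp
    then show ?thesis using L that by (simp add: scalar_prod_def atLeast0LessThan)
  qed
  have LP: "?L * P = 0\<^sub>m ?n ?n"
    using L rows
    by (intro eq_matI)
      (auto simp: P_def scalar_prod_def atLeast0LessThan simp flip: sum_divide_distrib)
  have PL: "P * ?L = 0\<^sub>m ?n ?n"
    using LP transpose_mult[OF L P] Pt laplacian_symmetric by simp
  have PP: "P * P = P"
    by (intro eq_matI) (auto simp: P_def scalar_prod_def)
  have "P *\<^sub>v v = v" if v: "v \<in> carrier_vec ?n" "?L *\<^sub>v v = 0\<^sub>v ?n" for v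
  proof (rule eq_vecI)
    fix i assume "i < dim_vec v"
    then have i: "i < ?n" using v by simp
    have "(P *\<^sub>v v) $ i = (\<Sum>k<?n. 1 / real ?n * v $ k)"
      using i v by (simp add: P_def scalar_prod_def atLeast0LessThan)
    also have "\<dots> = (\<Sum>k<?n. 1 / real ?n * v $ i)"
      using laplacian_kernel[OF G v _ i] by (intro sum.cong) auto
    finally show "(P *\<^sub>v v) $ i = v $ i" using i by simp
  qed (use v P in simp)
  then show ?thesis
    by (rule moore_penrose_from_kernel_projection[OF L P PP Pt LP PL])
qed

text \<open>The injected current lies in the range of the Laplacian, so its form under the
  pseudoinverse is its scalar product with \<open>v\<close>, which reads off two entries.\<close>

lemma resistance_distance_eq_potential_difference:
  assumes G: "simple_graph G" "connected_graph G"
    and ij: "i \<in> {1..fst G}" "j \<in> {1..fst G}"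
    and v: "v \<in> carrier_vec (fst G)"
    and Lv: "laplacian G *\<^sub>v v = unit_vec (fst G) (i - 1) - unit_vec (fst G) (j - 1)"
  shows "resistance_distance G i j = v $ (i - 1) - v $ (j - 1)"
proof -
  obtain X where X: "is_moore_penrose_inverse (laplacian G) X"
    using laplacian_moore_penrose_exists[OF G] ..
  have "resistance_distance G i j = v \<bullet> (laplacian G *\<^sub>v v)"
    unfolding resistance_distance_def Let_def Lv[symmetric] moore_penrose_inverse_eqI[OF X]
    by (rule moore_penrose_quadratic_form[OF X laplacian_carrier laplacian_symmetric v])
  also have "\<dots> = v $ (i - 1) - v $ (j - 1)"
    unfolding Lv using v ij
    by (subst scalar_prod_minus_distrib[of _ "fst G"]) (auto)
  finally show ?thesis .
qed

section \<open>The straight linear 2-tree\<close>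

lemma fst_straight_linear_2tree [simp]: "fst (straight_linear_2tree n) = n"
  by (simp add: straight_linear_2tree_def)

lemma edge_straight_linear_2tree:
  "{u, v} \<in> snd (straight_linear_2tree n) \<longleftrightarrow>
     u \<in> {1..n} \<and> v \<in> {1..n} \<and> u \<noteq> v \<and> u \<le> v + 2 \<and> v \<le> u + 2"
proof -
  have "0 < \<bar>int a - int b\<bar> \<and> \<bar>int a - int b\<bar> \<le> 2 \<longleftrightarrow> a \<noteq> b \<and> a \<le> b + 2 \<and> b \<le> a + 2" for a b
    by (cases "a \<le> b") auto
  then show ?thesis
    unfolding straight_linear_2tree_def by (auto simp: doubleton_eq_iff)
qed

lemma simple_straight_linear_2tree: "simple_graph (straight_linear_2tree n)"
  by (auto simp: simple_graph_def straight_linear_2tree_def)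

lemma connected_straight_linear_2tree: "connected_graph (straight_linear_2tree n)"
proof -
  let ?E = "{(a, b). {a, b} \<in> snd (straight_linear_2tree n)}"
  \<comment> \<open>The path through consecutive vertices connects the graph; symmetry gives the
    other direction.\<close>
  have up: "(u, v) \<in> ?E\<^sup>*" if "u \<le> v" "1 \<le> u" "v \<le> n" for u v
    using that
  proof (induction v rule: dec_induct)
    case (step v)
    then have "(v, Suc v) \<in> ?E"
      by (auto simp: edge_straight_linear_2tree)
    with step show ?case by (simp add: rtrancl.rtrancl_into_rtrancl)
  qed simp
  have "sym (?E\<^sup>*)"
    by (intro sym_rtrancl symI) (simp add: insert_commute)
  then show ?thesis
    unfolding connected_graph_def using up
    by (metis atLeastAtMost_iff fst_straight_linear_2tree nle_le symD)
qed

lemma adj_straight_linear_2tree: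
  assumes "i < n" "j < n"
  shows "adj (straight_linear_2tree n) i j = (if i \<noteq> j \<and> i \<le> j + 2 \<and> j \<le> i + 2 then 1 else 0)"
  using assms by (auto simp: adj_def edge_straight_linear_2tree)

lemma laplacian_straight_linear_2tree_mult_vec:
  assumes "i < n"
  shows "(laplacian (straight_linear_2tree n) *\<^sub>v vec n x) $ i
           = (\<Sum>j \<in> {j. j < n \<and> i \<noteq> j \<and> i \<le> j + 2 \<and> j \<le> i + 2}. x i - x j)"
proof -
  have "(laplacian (straight_linear_2tree n) *\<^sub>v vec n x) $ i
          = (\<Sum>j<n. if i \<noteq> j \<and> i \<le> j + 2 \<and> j \<le> i + 2 then x i - x j else 0)"
    using laplacian_mult_vec_index[OF simple_straight_linear_2tree, of "vec n x" n i] assms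
    by (auto simp: adj_straight_linear_2tree intro!: sum.cong)
  then show ?thesis
    by (simp add: sum.inter_filter[symmetric])
qed

text \<open>The potential is found from its drops \<open>d k = x (k - 1) - x k\<close>: a unit current through
  every cut means \<open>d (k - 1) + 3 * d k + d (k + 1) = 1\<close>, a recursion with characteristic polynomial
  \<open>t\<^sup>2 + 3 * t + 1\<close>, whose roots are \<open>\<beta>\<close> and \<open>1 / \<beta>\<close>. At the two ends, where a cut meets only two
  edges, the recursion persists for fictitious drops \<open>d 0 = - d 1\<close> and \<open>d n = - d (n - 1)\<close>;
  these fix the amplitude of the homogeneous part.\<close>

definition beta :: real  ("\<beta>") where
  "\<beta> = (sqrt 5 - 3) / 2"

lemma beta_root: "\<beta>\<^sup>2 = - 3 * \<beta> - 1"
  by (simp add: beta_def power2_eq_square field_simps)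

lemma beta_bounds: "- 1 < \<beta>" "\<beta> < 0"
proof -
  have "1 < sqrt 5" "sqrt 5 < 3"
    by (simp_all add: real_less_rsqrt real_less_lsqrt)
  then show "- 1 < \<beta>" "\<beta> < 0" by (simp_all add: beta_def)
qed

text \<open>Obtained by solving \<open>voltage_drop n 0 + voltage_drop n 1 = 0\<close>: the powers
  of \<open>\<beta>\<close> in it sum to
  \<open>(1 + \<beta>) * (1 + \<beta> ^ (n - 1))\<close>.\<close>

definition amplitude :: "nat \<Rightarrow> real" where
  "amplitude n = 2 / ((1 + \<beta>) * (1 + \<beta> ^ (n - 1)))"

text \<open>Indexed from \<open>0\<close> like vector entries. Summing the drops as geometric series
  gives this form up to an additive constant, which cancels in differences.\<close>

definition potential :: "nat \<Rightarrow> nat \<Rightarrow> real" where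
  "potential n k = - (real k + amplitude n * (\<beta> ^ (k + 1) - \<beta> ^ (n - k)) / (1 - \<beta>)) / 5"

lemma amplitude_eq:
  assumes "2 \<le> n"
  shows "amplitude n * (1 + \<beta>) * (1 + \<beta> ^ (n - 1)) = 2"
proof -
  have "\<bar>\<beta> ^ (n - 1)\<bar> < 1"
    using assms beta_bounds by (simp add: power_abs power_less_one_iff)
  then have "(1 + \<beta>) * (1 + \<beta> ^ (n - 1)) \<noteq> 0" using beta_bounds by simp
  then show ?thesis unfolding amplitude_def mult.assoc by (rule nonzero_eq_divide_eq[THEN iffD1]) simp
qed

text \<open>The constant solution is \<open>1 / 5\<close>; \<open>\<beta> ^ (n - k)\<close> is a
  multiple of \<open>(1 / \<beta>) ^ k\<close>, and equal coefficients make the drops symmetric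
  under reversal. The values at \<open>0\<close> and \<open>n\<close> are the fictitious
  drops.\<close>

definition voltage_drop :: "nat \<Rightarrow> nat \<Rightarrow> real" where
  "voltage_drop n k = (1 - amplitude n * (\<beta> ^ k + \<beta> ^ (n - k))) / 5"

lemma voltage_drop_recursion:
  assumes "k + 2 \<le> n"
  shows "voltage_drop n k + 3 * voltage_drop n (k + 1) + voltage_drop n (k + 2) = 1"
proof -
  obtain m where n: "n = k + 2 + m" using assms by (rule less_eqE)
  \<comment> \<open>Being palindromic, the characteristic polynomial also annihilates the reversed
    powers, so this fact serves both \<open>k\<close> and \<open>m\<close>.\<close>
  have *: "\<beta> ^ k + 3 * \<beta> ^ (k + 1) + \<beta> ^ (k + 2) = 0" for k
  proof -
    have "\<beta> ^ k + 3 * \<beta> ^ (k + 1) + \<beta> ^ (k + 2) = \<beta> ^ k * (1 + 3 * \<beta> + \<beta>\<^sup>2)"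
      by (simp add: power_add distrib_left power2_eq_square)
    then show ?thesis by (simp add: beta_root)
  qed
  have "voltage_drop n k + 3 * voltage_drop n (k + 1) + voltage_drop n (k + 2)
          = 1 - amplitude n / 5 * ((\<beta> ^ k + 3 * \<beta> ^ (k + 1) + \<beta> ^ (k + 2))
                           + (\<beta> ^ m + 3 * \<beta> ^ (m + 1) + \<beta> ^ (m + 2)))"
    by (simp add: voltage_drop_def n field_simps)
  then show ?thesis unfolding * by simp
qed

lemma voltage_drop_reflect: "k \<le> n \<Longrightarrow> voltage_drop n (n - k) = voltage_drop n k"
  by (simp add: voltage_drop_def add.commute)

lemma voltage_drop_boundary:
  assumes "2 \<le> n"
  shows "voltage_drop n 0 + voltage_drop n 1 = 0"
proof -
  have "\<beta> ^ n = \<beta> * \<beta> ^ (n - 1)" using assms by (simp flip: power_Suc)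
  then have "amplitude n * (1 + \<beta> ^ n) + amplitude n * (\<beta> + \<beta> ^ (n - 1)) = 2"
    using amplitude_eq[OF assms] by (simp add: algebra_simps)
  then show ?thesis unfolding voltage_drop_def by (simp flip: add_divide_distrib)
qed

lemma potential_diff:
  assumes "k < n"
  shows "potential n k - potential n (k + 1) = voltage_drop n (k + 1)"
proof -
  have e: "\<beta> ^ (n - k) = \<beta> * \<beta> ^ (n - (k + 1))"
    using assms by (simp flip: power_Suc add: Suc_diff_Suc)
  have "1 - \<beta> \<noteq> 0" using beta_bounds by simp
  \<comment> \<open>Consecutive differences of both powers contain the factor
    \<open>1 - \<beta>\<close>, which cancels the denominator.\<close>
  then have quot: "(\<beta> ^ (k + 2) - \<beta> ^ (n - (k + 1))) / (1 - \<beta>)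
                 - (\<beta> ^ (k + 1) - \<beta> ^ (n - k)) / (1 - \<beta>)
               = - (\<beta> ^ (k + 1) + \<beta> ^ (n - (k + 1)))"
    unfolding e diff_divide_distrib[symmetric]
    by (simp add: divide_eq_eq) (simp add: algebra_simps)
  have "potential n k - potential n (k + 1)
      = (1 + amplitude n * ((\<beta> ^ (k + 2) - \<beta> ^ (n - (k + 1))) / (1 - \<beta>)
                          - (\<beta> ^ (k + 1) - \<beta> ^ (n - k)) / (1 - \<beta>))) / 5"
    by (simp add: potential_def right_diff_distrib add_divide_distrib diff_divide_distrib)
  then show ?thesis
    unfolding quot voltage_drop_def by (simp add: algebra_simps)
qed

text \<open>At an interior index \<open>i\<close> the net current is the recursion at
  \<open>i\<close> minus the recursion at \<open>i - 1\<close>, so \<open>1 - 1 = 0\<close>. Near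
  the ends the fictitious drops supply the missing terms.\<close>

lemma laplacian_potential:
  assumes n: "4 \<le> n"
  shows "laplacian (straight_linear_2tree n) *\<^sub>v vec n (potential n) = unit_vec n 0 - unit_vec n (n - 1)"
proof (rule eq_vecI)
  fix i assume "i < dim_vec (unit_vec n 0 - unit_vec n (n - 1) :: real vec)"
  then have i: "i < n" by simp
  let ?x = "potential n"
  let ?N = "{j. j < n \<and> i \<noteq> j \<and> i \<le> j + 2 \<and> j \<le> i + 2}"
  have "(\<Sum>j \<in> ?N. ?x i - ?x j) = (if i = 0 then 1 else 0) - (if i = n - 1 then 1 else 0)"
  proof -
    \<comment> \<open>The two indices nearest each end have truncated neighbourhoods;
      \<open>4 \<le> n\<close> keeps these four cases apart.\<close>
    consider "i = 0" | "i = 1" | "i = n - 2" | "i = n - 1" | "2 \<le> i" "i + 3 \<le> n"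
      using i by linarith
    then show ?thesis
    proof cases
      case 1
      then have "?N = {1, 2}" using n by auto
      then show ?thesis
        using 1 n potential_diff[of 0 n] potential_diff[of 1 n]
          voltage_drop_recursion[of 0 n] voltage_drop_boundary[of n]
        by (simp add: numeral_2_eq_2)
    next
      case 2
      then have "?N = {0, 2, 3}" using n by auto
      then show ?thesis
        using 2 n potential_diff[of 0 n] potential_diff[of 1 n] potential_diff[of 2 n]
          voltage_drop_recursion[of 0 n] voltage_drop_recursion[of 1 n] voltage_drop_boundary[of n]
        by (simp add: eval_nat_numeral)
    next
      case 3
      \<comment> \<open>Reflection transfers the boundary condition from the left end to the right
        one; \<open>m\<close> avoids truncated subtraction.\<close>
      obtain m where m: "n = 4 + m" using n by (rule less_eqE)
      have "?N = {m, m + 1, m + 3}" using 3 m by auto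
      then show ?thesis
        using 3 m potential_diff[of m n] potential_diff[of "m + 1" n] potential_diff[of "m + 2" n]
          voltage_drop_recursion[of "m + 1" n] voltage_drop_recursion[of "m + 2" n] voltage_drop_boundary[of n]
          voltage_drop_reflect[of 0 n] voltage_drop_reflect[of 1 n]
        by (simp add: eval_nat_numeral)
    next
      case 4
      obtain m where m: "n = 4 + m" using n by (rule less_eqE)
      have "?N = {m + 1, m + 2}" using 4 m by auto
      then show ?thesis
        using 4 m potential_diff[of "m + 1" n] potential_diff[of "m + 2" n]
          voltage_drop_recursion[of "m + 2" n] voltage_drop_boundary[of n]
          voltage_drop_reflect[of 0 n] voltage_drop_reflect[of 1 n]
        by (simp add: eval_nat_numeral)
    next
      case 5
      obtain m where m: "i = 2 + m" using 5(1) by (rule less_eqE)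
      have "?N = {m, m + 1, m + 3, m + 4}" using 5 m by auto
      moreover have "i \<noteq> 0" "i \<noteq> n - 1" using 5 by auto
      ultimately show ?thesis
        using 5(2) m potential_diff[of m n] potential_diff[of "m + 1" n] potential_diff[of "m + 2" n]
          potential_diff[of "m + 3" n]
          voltage_drop_recursion[of "m + 1" n] voltage_drop_recursion[of "m + 2" n]
        by (simp add: eval_nat_numeral)
    qed
  qed
  then show "(laplacian (straight_linear_2tree n) *\<^sub>v vec n ?x) $ i = (unit_vec n 0 - unit_vec n (n - 1)) $ i"
    using laplacian_straight_linear_2tree_mult_vec[OF i] i n by (simp add: unit_vec_def)
qed (use laplacian_carrier[of "straight_linear_2tree n"] in simp)

section \<open>End-to-end resistance and its limit\<close>

lemma resistance_distance_ends:
  assumes n: "4 \<le> n"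
  shows "resistance_distance (straight_linear_2tree n) 1 n
           = (real n - 1 + 4 * (\<beta> ^ n - \<beta>) / ((1 + \<beta>) * (1 - \<beta>) * (1 + \<beta> ^ (n - 1)))) / 5"
proof -
  have "resistance_distance (straight_linear_2tree n) 1 n = potential n 0 - potential n (n - 1)"
    using resistance_distance_eq_potential_difference[OF simple_straight_linear_2tree
        connected_straight_linear_2tree, of 1 n n "vec n (potential n)"]
      laplacian_potential[OF n] n
    by simp
  \<comment> \<open>The correction term changes sign under reversal, so both ends contribute
    equally; hence the factor \<open>2\<close>.\<close>
  also have "\<dots> = (real n - 1 + 2 * (amplitude n * (\<beta> ^ n - \<beta>) / (1 - \<beta>))) / 5"
  proof -
    have "\<beta> ^ 1 - \<beta> ^ n = - (\<beta> ^ n - \<beta>)" by simp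
    then show ?thesis
      using n by (simp add: potential_def minus_divide_left[symmetric] diff_divide_distrib
          add_divide_distrib right_diff_distrib)
  qed
  also have "2 * (amplitude n * (\<beta> ^ n - \<beta>) / (1 - \<beta>)) = 4 * (\<beta> ^ n - \<beta>) / ((1 + \<beta>) * (1 - \<beta>) * (1 + \<beta> ^ (n - 1)))"
    by (simp add: amplitude_def mult_ac)
  finally show ?thesis .
qed

theorem theorem3p5:
  shows "(\<lambda>n. resistance_distance (straight_linear_2tree (n + 1)) 1 (n + 1)
            - resistance_distance (straight_linear_2tree n) 1 n) \<longlonglongrightarrow> 1 / 5"
proof -
  \<comment> \<open>\<open>g\<close> collects the end corrections. It converges, so its successive
    differences tend to zero and only the linear term contributes.\<close>
  define g where "g n = 4 * (\<beta> ^ n - \<beta>) / ((1 + \<beta>) * (1 - \<beta>) * (1 + \<beta> ^ (n - 1)))" for n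
  \<comment> \<open>The zeros remain so that \<open>l\<close> has the shape the limit rules
    produce.\<close>
  define l where "l = 4 * (0 - \<beta>) / ((1 + \<beta>) * (1 - \<beta>) * (1 + 0))"
  have "(\<lambda>n. \<beta> ^ n) \<longlonglongrightarrow> 0"
    using beta_bounds by (intro LIMSEQ_power_zero) simp
  moreover from this have "(\<lambda>n. \<beta> ^ (n - 1)) \<longlonglongrightarrow> 0"
    using LIMSEQ_imp_Suc[of "\<lambda>n. \<beta> ^ (n - 1)" 0] by simp
  ultimately have g: "g \<longlonglongrightarrow> l"
    unfolding g_def l_def using beta_bounds by (intro tendsto_intros) auto
  have "(\<lambda>n. g (n + 1)) \<longlonglongrightarrow> l"
    using LIMSEQ_Suc[OF g] by simp
  with g have lim: "(\<lambda>n. (1 + (g (n + 1) - g n)) / 5) \<longlonglongrightarrow> (1 + (l - l)) / 5"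
    by (intro tendsto_intros) auto
  have ends: "resistance_distance (straight_linear_2tree n) 1 n
      = (real n - 1 + g n) / 5" if "4 \<le> n" for n
    using resistance_distance_ends[OF that] by (simp only: g_def)
  have "\<forall>\<^sub>F n in sequentially. (1 + (g (n + 1) - g n)) / 5
      = resistance_distance (straight_linear_2tree (n + 1)) 1 (n + 1)
          - resistance_distance (straight_linear_2tree n) 1 n"
    \<comment> \<open>The closed form is available from \<open>4\<close> on and is applied at both
      \<open>n\<close> and \<open>n + 1\<close>.\<close>
    using eventually_ge_at_top[of 4]
    by eventually_elim (subst (1 2) ends, simp_all add: field_simps)
  then show ?thesis
    using Lim_transform_eventually[OF lim] by simp
qed

end
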